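(* Let $\Omega$ be a nonempty finite set and let $G \leq \operatorname{Sym}(\Omega)$. In graph backtracking (that is, with $\mathcal{O}$ the set of all labelled digraphs on the vertex set $\Omega$), there exists a perfect refiner for $G$ if and only if $G$ is 2-closed.
   Context: Actions are right actions, written by exponentiation. A digraph on a set $V$ is a pair $(V,A)$ with arc set $A \subseteq V\times V$ (loops allowed). A labelled digraph on $V$ is a digraph on $V$ together with an assignment of a label, from a fixed nonempty set of labels, to each vertex and each arc. $\operatorname{Sym}(V)$ acts on labelled digraphs on $V$ by renaming vertices: $\Gamma^g$ has arcs $(\alpha^g,\beta^g)$ for the arcs $(\alpha,\beta)$ of $\Gamma$, and $\alpha^g$, $(\alpha^g,\beta^g)$ have in $\Gamma^g$ the labels that $\alpha$, $(\alpha,\beta)$ have in $\Gamma$. For a set $\mathcal{O}$ on which $\operatorname{Sym}(\Omega)$ acts, $\operatorname{Stacks}(\mathcal{O})$ is the set of all finite lists (including the empty one) with entries in $\mathcal{O}$, on which $\operatorname{Sym}(\Omega)$ acts entrywise; $|S|$ is the length of a list $S$ and $S \Vert T$ is concatenation. For $x,y$ in a set on which $\operatorname{Sym}(\Omega)$ acts, $\operatorname{Transp}(x,y) = \{g\in\operatorname{Sym}(\Omega) : x^g=y\}$. A refiner for $U\subseteq\operatorname{Sym}(\Omega)$ (with respect to $\mathcal{O}$) is a pair $(f_L,f_R)$ of functions from $\operatorname{Stacks}(\mathcal{O})$ to itself such that $U\cap\operatorname{Transp}(S,T)\subseteq\operatorname{Transp}(f_L(S),f_R(T))$ for all $S,T\in\operatorname{Stacks}(\mathcal{O})$.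 It is a perfect refiner for $U$ if $U\cap\operatorname{Transp}(S,T)=\operatorname{Transp}(S\Vert f_L(S),\,T\Vert f_R(T))$ for all $S,T\in\operatorname{Stacks}(\mathcal{O})$ with $|S|=|T|$. The 2-closure of $G\leq\operatorname{Sym}(\Omega)$ is the largest subgroup of $\operatorname{Sym}(\Omega)$ with the same orbits on $\Omega\times\Omega$ as $G$ (for the action $(\alpha,\beta)^g=(\alpha^g,\beta^g)$). $G$ is 2-closed if it equals its 2-closure. *)

theory Defs
  imports "HOL-Algebra.Group_Action" "Graph_Theory.Pair_Digraph"
begin

section \<open>Symmetric groups and 2-closure\<close>

text \<open>Permutations act on the right, written exponentially: the image of \<open>\<alpha>\<close> under \<open>g\<close> is
  the value \<open>g \<alpha>\<close>, and the product \<open>g h\<close> means first \<open>g\<close>, then \<open>h\<close>.\<close>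

definition Sym :: "'a set \<Rightarrow> ('a \<Rightarrow> 'a) monoid" where
  "Sym \<Omega> = \<lparr> carrier = {g. g permutes \<Omega>}, monoid.mult = (\<lambda>g h. h \<circ> g), one = id \<rparr>"

definition orbitals :: "'a set \<Rightarrow> ('a \<Rightarrow> 'a) set \<Rightarrow> ('a \<times> 'a) set set" where
  "orbitals \<Omega> G = orbits (Sym \<Omega>\<lparr>carrier := G\<rparr>) (\<Omega> \<times> \<Omega>) (\<lambda>g (\<alpha>, \<beta>). (g \<alpha>, g \<beta>))"

text \<open>The order is set inclusion, so \<open>GREATEST\<close> denotes the subgroup with this property that
  contains every other such subgroup.\<close>

definition two_closure :: "'a set \<Rightarrow> ('a \<Rightarrow> 'a) set \<Rightarrow> ('a \<Rightarrow> 'a) set" where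
  "two_closure \<Omega> G = (GREATEST H. subgroup H (Sym \<Omega>) \<and> orbitals \<Omega> H = orbitals \<Omega> G)"

definition two_closed :: "'a set \<Rightarrow> ('a \<Rightarrow> 'a) set \<Rightarrow> bool" where
  "two_closed \<Omega> G \<longleftrightarrow> two_closure \<Omega> G = G"

section \<open>Labelled digraphs\<close>

record ('v, 'l) labelled_digraph =
  graph :: "'v pair_pre_digraph"
  vlabel :: "'v \<Rightarrow> 'l"
  alabel :: "'v \<times> 'v \<Rightarrow> 'l"

text \<open>Labellings are extensional functions, so that equality of records is equality of labelled
  digraphs. The locale \<^locale>\<open>pair_wf_digraph\<close> allows loops.\<close>

definition labelled_digraphs :: "'l set \<Rightarrow> 'v set \<Rightarrow> ('v, 'l) labelled_digraph set" where
  "labelled_digraphs L V =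
    {\<Gamma>. pair_wf_digraph (graph \<Gamma>) \<and> pverts (graph \<Gamma>) = V \<and>
        vlabel \<Gamma> \<in> V \<rightarrow>\<^sub>E L \<and> alabel \<Gamma> \<in> parcs (graph \<Gamma>) \<rightarrow>\<^sub>E L}"

definition rename ::
    "('v, 'l) labelled_digraph \<Rightarrow> ('v \<Rightarrow> 'v) \<Rightarrow> ('v, 'l) labelled_digraph" where
  "rename \<Gamma> g =
    (let V = pverts (graph \<Gamma>); A = parcs (graph \<Gamma>); g' = inv_into V g in
     \<lparr> graph = \<lparr> pverts = g ` V, parcs = map_prod g g ` A \<rparr>,
       vlabel = (\<lambda>\<alpha> \<in> g ` V. vlabel \<Gamma> (g' \<alpha>)),
       alabel = (\<lambda>(\<alpha>, \<beta>) \<in> map_prod g g ` A. alabel \<Gamma> (g' \<alpha>, g' \<beta>)) \<rparr>)"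

section \<open>Stacks and refiners\<close>

text \<open>Below, \<open>act x g\<close> is the image of \<open>x \<in> \<O>\<close> under \<open>g\<close> for a right action of the symmetric
  group on \<open>\<O>\<close>.\<close>

abbreviation Stacks :: "'x set \<Rightarrow> 'x list set" where
  "Stacks \<O> \<equiv> lists \<O>"

definition stack_act :: "('x \<Rightarrow> ('a \<Rightarrow> 'a) \<Rightarrow> 'x) \<Rightarrow> 'x list \<Rightarrow> ('a \<Rightarrow> 'a) \<Rightarrow> 'x list" where
  "stack_act act S g = map (\<lambda>x. act x g) S"

definition Transp ::
    "'a set \<Rightarrow> ('x \<Rightarrow> ('a \<Rightarrow> 'a) \<Rightarrow> 'x) \<Rightarrow> 'x \<Rightarrow> 'x \<Rightarrow> ('a \<Rightarrow> 'a) set" where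
  "Transp \<Omega> act x y = {g \<in> carrier (Sym \<Omega>). act x g = y}"

definition refiner ::
    "'a set \<Rightarrow> 'x set \<Rightarrow> ('x \<Rightarrow> ('a \<Rightarrow> 'a) \<Rightarrow> 'x) \<Rightarrow> ('a \<Rightarrow> 'a) set \<Rightarrow>
     ('x list \<Rightarrow> 'x list) \<Rightarrow> ('x list \<Rightarrow> 'x list) \<Rightarrow> bool" where
  "refiner \<Omega> \<O> act U f\<^sub>L f\<^sub>R \<longleftrightarrow>
    U \<subseteq> carrier (Sym \<Omega>) \<and>
    f\<^sub>L \<in> Stacks \<O> \<rightarrow> Stacks \<O> \<and> f\<^sub>R \<in> Stacks \<O> \<rightarrow> Stacks \<O> \<and>
    (\<forall>S \<in> Stacks \<O>. \<forall>T \<in> Stacks \<O>.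
      U \<inter> Transp \<Omega> (stack_act act) S T \<subseteq> Transp \<Omega> (stack_act act) (f\<^sub>L S) (f\<^sub>R T))"

definition perfect_refiner ::
    "'a set \<Rightarrow> 'x set \<Rightarrow> ('x \<Rightarrow> ('a \<Rightarrow> 'a) \<Rightarrow> 'x) \<Rightarrow> ('a \<Rightarrow> 'a) set \<Rightarrow>
     ('x list \<Rightarrow> 'x list) \<Rightarrow> ('x list \<Rightarrow> 'x list) \<Rightarrow> bool" where
  "perfect_refiner \<Omega> \<O> act U f\<^sub>L f\<^sub>R \<longleftrightarrow>
    refiner \<Omega> \<O> act U f\<^sub>L f\<^sub>R \<and>
    (\<forall>S \<in> Stacks \<O>. \<forall>T \<in> Stacks \<O>. length S = length T \<longrightarrow>
      U \<inter> Transp \<Omega> (stack_act act) S T =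
      Transp \<Omega> (stack_act act) (S @ f\<^sub>L S) (T @ f\<^sub>R T))"

end

(* The largest group with the orbitals of G consists of the permutations that act on each pair of
   points like some element of G. Such a permutation preserves every labelled digraph that G
   preserves, because arcs and labels only see pairs of points. A perfect refiner, applied to the
   empty stacks, exhibits G as the stabiliser of a list of labelled digraphs, so G is 2-closed.
   Conversely, a 2-closed group is the stabiliser of the list of its orbital digraphs, and appending
   this fixed list to every stack is a perfect refiner. *)

theory Submission
  imports Defs
begin

section \<open>The symmetric group; \<open>inv\<close> is the inverse function throughout\<close>

unbundle no m_inv_syntax

lemma carrier_Sym [simp]: "carrier (Sym \<Omega>) = {g. g permutes \<Omega>}"
  by (simp add: Sym_def)

lemma mult_Sym [simp]: "g \<otimes>\<^bsub>Sym \<Omega>\<^esub> h = h \<circ> g"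
  by (simp add: Sym_def)

lemma one_Sym [simp]: "\<one>\<^bsub>Sym \<Omega>\<^esub> = id"
  by (simp add: Sym_def)

lemma group_Sym: "group (Sym \<Omega>)"
proof (rule groupI)
  fix g assume "g \<in> carrier (Sym \<Omega>)"
  then show "\<exists>h\<in>carrier (Sym \<Omega>). h \<otimes>\<^bsub>Sym \<Omega>\<^esub> g = \<one>\<^bsub>Sym \<Omega>\<^esub>"
    by (intro bexI[of _ "inv g"]) (auto simp: permutes_inv permutes_inv_o)
qed (auto simp: permutes_compose permutes_id comp_assoc)

lemma inv_Sym: "g permutes \<Omega> \<Longrightarrow> m_inv (Sym \<Omega>) g = inv g"
  by (rule group.inv_equality[OF group_Sym]) (auto simp: permutes_inv permutes_inv_o)

lemma subgroup_Sym_iff: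
  "subgroup G (Sym \<Omega>) \<longleftrightarrow>
    (\<forall>g\<in>G. g permutes \<Omega> \<and> inv g \<in> G) \<and> id \<in> G \<and> (\<forall>g\<in>G. \<forall>h\<in>G. h \<circ> g \<in> G)"
  by (auto simp: subgroup_def inv_Sym subset_iff)

section \<open>Orbits on ordered pairs\<close>

definition pair_orbit :: "('a \<Rightarrow> 'a) set \<Rightarrow> 'a \<times> 'a \<Rightarrow> ('a \<times> 'a) set" where
  "pair_orbit G p = (\<lambda>g. map_prod g g p) ` G"

lemma orbitals_eq: "orbitals \<Omega> G = pair_orbit G ` (\<Omega> \<times> \<Omega>)"
proof -
  have "(\<lambda>(\<alpha>, \<beta>). (g \<alpha>, g \<beta>)) = map_prod g g" for g :: "'a \<Rightarrow> 'a"
    by auto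
  then show ?thesis
    by (auto simp: orbitals_def orbits_def orbit_def pair_orbit_def image_def)
qed

lemma self_mem_pair_orbit: "subgroup G (Sym \<Omega>) \<Longrightarrow> p \<in> pair_orbit G p"
  unfolding pair_orbit_def subgroup_Sym_iff
  by (rule image_eqI[of _ _ id]) (simp_all add: prod.map_id0)

lemma pair_orbitI: "g \<in> G \<Longrightarrow> map_prod g g p \<in> pair_orbit G p"
  by (simp add: pair_orbit_def)

lemma pair_orbitE:
  assumes "q \<in> pair_orbit G p"
  obtains g where "g \<in> G" "q = map_prod g g p"
  using assms by (auto simp: pair_orbit_def)

lemma map_prod_mem_pair_orbit:
  assumes G: "subgroup G (Sym \<Omega>)" and g: "g \<in> G" and q: "q \<in> pair_orbit G p"
  shows "map_prod g g q \<in> pair_orbit G p"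
proof -
  obtain h where "h \<in> G" "q = map_prod h h p"
    using q by (auto simp: pair_orbit_def)
  then show ?thesis
    using G g unfolding pair_orbit_def subgroup_Sym_iff
    by (intro image_eqI[of _ _ "g \<circ> h"]) (auto simp: map_prod.compositionality)
qed

text \<open>If \<open>h\<close> carries \<open>p\<close> to \<open>q\<close>, then
  \<open>inv h\<close> carries \<open>q\<close> back to \<open>p\<close>. The situation is thus
  symmetric, and both inclusions follow from the invariance of an orbit under
  \<open>G\<close>.\<close>

lemma pair_orbit_eq:
  assumes G: "subgroup G (Sym \<Omega>)" and q: "q \<in> pair_orbit G p"
  shows "pair_orbit G q = pair_orbit G p"
proof
  show "pair_orbit G q \<subseteq> pair_orbit G p"
    using map_prod_mem_pair_orbit[OF G _ q] by (blast elim: pair_orbitE)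
  obtain h where h: "h \<in> G" "q = map_prod h h p"
    using q by (auto simp: pair_orbit_def)
  have inv: "inv h \<in> G" "p = map_prod (inv h) (inv h) q"
    using G h by (auto simp: subgroup_Sym_iff permutes_inverses prod.map_comp permutes_inv_o
        prod.map_id)
  then have "p \<in> pair_orbit G q"
    by (metis pair_orbitI)
  then show "pair_orbit G p \<subseteq> pair_orbit G q"
    using map_prod_mem_pair_orbit[OF G] by (blast elim: pair_orbitE)
qed

section \<open>An explicit description of the 2-closure\<close>

text \<open>The element of \<open>G\<close> that agrees with \<open>g\<close> may change from pair
  to pair. For a subgroup \<open>G\<close> this turns out to be the set that \<open>GREATEST\<close>
  selects in \<open>two_closure\<close>.\<close>

definition pairwise_closure :: "'a set \<Rightarrow> ('a \<Rightarrow> 'a) set \<Rightarrow> ('a \<Rightarrow> 'a) set" where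
  "pairwise_closure \<Omega> G = {g. g permutes \<Omega> \<and> (\<forall>p \<in> \<Omega> \<times> \<Omega>. map_prod g g p \<in> pair_orbit G p)}"

lemma pairwise_closureD:
  "g \<in> pairwise_closure \<Omega> G \<Longrightarrow> p \<in> \<Omega> \<times> \<Omega> \<Longrightarrow> map_prod g g p \<in> pair_orbit G p"
  unfolding pairwise_closure_def by (elim CollectE conjE bspec)

lemma mem_pairwise_closureE:
  assumes "g \<in> pairwise_closure \<Omega> G" "\<alpha> \<in> \<Omega>" "\<beta> \<in> \<Omega>"
  obtains h where "h \<in> G" "g \<alpha> = h \<alpha>" "g \<beta> = h \<beta>"
  using assms unfolding pairwise_closure_def pair_orbit_def by fastforce

lemma subset_pairwise_closure: "subgroup G (Sym \<Omega>) \<Longrightarrow> G \<subseteq> pairwise_closure \<Omega> G"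
  by (auto simp: pairwise_closure_def pair_orbit_def subgroup_Sym_iff)

lemma map_prod_mem_times: "g permutes \<Omega> \<Longrightarrow> p \<in> \<Omega> \<times> \<Omega> \<Longrightarrow> map_prod g g p \<in> \<Omega> \<times> \<Omega>"
  by (auto simp: permutes_in_image)

text \<open>The pair orbits of \<open>G\<close> are equivalence classes, and a member of the closure
  moves each pair within its class. This property passes to inverses and products.\<close>

lemma subgroup_pairwise_closure:
  assumes G: "subgroup G (Sym \<Omega>)"
  shows "subgroup (pairwise_closure \<Omega> G) (Sym \<Omega>)"
  unfolding subgroup_Sym_iff
proof (intro conjI ballI)
  show "id \<in> pairwise_closure \<Omega> G"
    using subset_pairwise_closure[OF G] G by (auto simp: subgroup_Sym_iff)
  fix g assume g: "g \<in> pairwise_closure \<Omega> G"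
  then show perm: "g permutes \<Omega>"
    by (simp add: pairwise_closure_def)
  have "map_prod (inv g) (inv g) p \<in> pair_orbit G p" if p: "p \<in> \<Omega> \<times> \<Omega>" for p
  proof -
    let ?q = "map_prod (inv g) (inv g) p"
    \<comment> \<open>The closure property of \<open>g\<close> is used at the preimage
      \<open>?q\<close>: as \<open>g\<close> takes \<open>?q\<close> to \<open>p\<close>, both lie
      in one orbit.\<close>
    have "?q \<in> \<Omega> \<times> \<Omega>"
      by (rule map_prod_mem_times[OF permutes_inv[OF perm] p])
    then have "map_prod g g ?q \<in> pair_orbit G ?q"
      by (rule pairwise_closureD[OF g])
    moreover have "map_prod g g ?q = p"
      by (cases p) (simp add: permutes_inverses[OF perm])
    ultimately show ?thesis
      using pair_orbit_eq[OF G, of p ?q] self_mem_pair_orbit[OF G, of ?q] by simp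
  qed
  then show "inv g \<in> pairwise_closure \<Omega> G"
    using permutes_inv[OF perm] unfolding pairwise_closure_def by blast
  fix h assume h: "h \<in> pairwise_closure \<Omega> G"
  have "map_prod (h \<circ> g) (h \<circ> g) p \<in> pair_orbit G p" if p: "p \<in> \<Omega> \<times> \<Omega>" for p
  proof -
    have "map_prod h h (map_prod g g p) \<in> pair_orbit G (map_prod g g p)"
      by (rule pairwise_closureD[OF h map_prod_mem_times[OF perm p]])
    also have "\<dots> = pair_orbit G p"
      by (rule pair_orbit_eq[OF G pairwise_closureD[OF g p]])
    finally show ?thesis
      by (simp add: prod.map_comp)
  qed
  then show "h \<circ> g \<in> pairwise_closure \<Omega> G"
    using g h by (auto simp: pairwise_closure_def permutes_compose)
qed

text \<open>The orbits agree pair by pair: enlarging \<open>G\<close> can only enlarge an orbit,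
  while the definition of the closure keeps it inside the orbit of \<open>G\<close>.\<close>

lemma orbitals_pairwise_closure:
  assumes G: "subgroup G (Sym \<Omega>)"
  shows "orbitals \<Omega> (pairwise_closure \<Omega> G) = orbitals \<Omega> G"
  unfolding orbitals_eq
proof (rule image_cong[OF refl])
  fix p assume p: "p \<in> \<Omega> \<times> \<Omega>"
  show "pair_orbit (pairwise_closure \<Omega> G) p = pair_orbit G p"
  proof
    show "pair_orbit (pairwise_closure \<Omega> G) p \<subseteq> pair_orbit G p"
      using p by (auto simp: pairwise_closure_def elim!: pair_orbitE simp del: map_prod_simp)
    show "pair_orbit G p \<subseteq> pair_orbit (pairwise_closure \<Omega> G) p"
      using subset_pairwise_closure[OF G] unfolding pair_orbit_def by blast
  qed
qed

text \<open>This is the maximality needed for \<open>GREATEST\<close>.\<close>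

lemma subset_pairwise_closure_of_orbitals_eq:
  assumes G: "subgroup G (Sym \<Omega>)" and H: "subgroup H (Sym \<Omega>)"
    and eq: "orbitals \<Omega> H = orbitals \<Omega> G"
  shows "H \<subseteq> pairwise_closure \<Omega> G"
proof
  fix g assume g: "g \<in> H"
  have "map_prod g g p \<in> pair_orbit G p" if p: "p \<in> \<Omega> \<times> \<Omega>" for p
  proof -
    \<comment> \<open>Equality of the two families only provides some \<open>q\<close>. Since
      \<open>p\<close> lies in its own \<open>H\<close>-orbit, it lies in the \<open>G\<close>-orbit
      of \<open>q\<close>, which is therefore the \<open>G\<close>-orbit of
      \<open>p\<close>.\<close>
    obtain q where q: "pair_orbit H p = pair_orbit G q"
      using p eq unfolding orbitals_eq by blast
    then have "pair_orbit H p = pair_orbit G p"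
      using self_mem_pair_orbit[OF H, of p] pair_orbit_eq[OF G] by auto
    then show ?thesis
      using g by (auto simp: pair_orbit_def)
  qed
  then show "g \<in> pairwise_closure \<Omega> G"
    using g H by (auto simp: pairwise_closure_def subgroup_Sym_iff)
qed

lemma two_closure_eq:
  assumes "subgroup G (Sym \<Omega>)"
  shows "two_closure \<Omega> G = pairwise_closure \<Omega> G"
  unfolding two_closure_def
  by (rule Greatest_equality)
    (use assms in \<open>auto simp: subgroup_pairwise_closure orbitals_pairwise_closure
       dest: subset_pairwise_closure_of_orbitals_eq\<close>)

section \<open>Permutations that fix a labelled digraph\<close>

text \<open>Substituting images under \<open>g\<close> for points removes \<open>inv_into\<close>
  from the definition of \<open>rename\<close>, so that invariance can be tested one point or one
  pair at a time. The vertex set is fixed because \<open>g\<close> permutes it.\<close>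

lemma rename_eq_iff:
  assumes \<Gamma>: "\<Gamma> \<in> labelled_digraphs L V" and g: "g permutes V"
  shows "rename \<Gamma> g = \<Gamma> \<longleftrightarrow>
    map_prod g g ` parcs (graph \<Gamma>) = parcs (graph \<Gamma>) \<and>
    (\<forall>\<alpha>\<in>V. vlabel \<Gamma> (g \<alpha>) = vlabel \<Gamma> \<alpha>) \<and>
    (\<forall>p\<in>parcs (graph \<Gamma>). alabel \<Gamma> (map_prod g g p) = alabel \<Gamma> p)"
    (is "_ \<longleftrightarrow> ?arcs \<and> ?vlab \<and> ?alab")
proof -
  let ?A = "parcs (graph \<Gamma>)" and ?g' = "inv_into V g"
  have V: "pverts (graph \<Gamma>) = V" and AV: "?A \<subseteq> V \<times> V"
    and vl: "vlabel \<Gamma> \<in> extensional V" and al: "alabel \<Gamma> \<in> extensional ?A"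
    using \<Gamma> pair_wf_digraph.in_arcsD1 pair_wf_digraph.in_arcsD2
    by (auto simp: labelled_digraphs_def PiE_def)
  have gV: "g ` V = V" and inj: "inj_on g V"
    using g by (auto simp: permutes_image permutes_inj_on)
  have g'g: "?g' (g \<alpha>) = \<alpha>" if "\<alpha> \<in> V" for \<alpha>
    using that inj by simp
  have "rename \<Gamma> g = \<Gamma> \<longleftrightarrow> ?arcs \<and>
      (\<lambda>\<alpha>\<in>V. vlabel \<Gamma> (?g' \<alpha>)) = vlabel \<Gamma> \<and>
      (\<lambda>(\<alpha>, \<beta>)\<in>map_prod g g ` ?A. alabel \<Gamma> (?g' \<alpha>, ?g' \<beta>)) = alabel \<Gamma>"
    by (cases \<Gamma>; cases "graph \<Gamma>") (use V gV in \<open>auto simp: rename_def Let_def\<close>)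
  \<comment> \<open>Both functions are extensional on \<open>V\<close>, so only values on
    \<open>V\<close> matter; writing \<open>V\<close> as its image under \<open>g\<close> prepares
    the substitution.\<close>
  also have "(\<lambda>\<alpha>\<in>V. vlabel \<Gamma> (?g' \<alpha>)) = vlabel \<Gamma> \<longleftrightarrow>
      (\<forall>\<alpha>\<in>g ` V. vlabel \<Gamma> (?g' \<alpha>) = vlabel \<Gamma> \<alpha>)"
    unfolding gV using vl by (auto simp: fun_eq_iff restrict_def extensional_def)
  also have "\<dots> \<longleftrightarrow> ?vlab"
    using g'g by auto
  also have "(?arcs \<and> ?vlab \<and>
      (\<lambda>(\<alpha>, \<beta>)\<in>map_prod g g ` ?A. alabel \<Gamma> (?g' \<alpha>, ?g' \<beta>)) = alabel \<Gamma>) \<longleftrightarrow>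
      ?arcs \<and> ?vlab \<and>
      (\<forall>p\<in>map_prod g g ` ?A. alabel \<Gamma> (map_prod ?g' ?g' p) = alabel \<Gamma> p)"
  \<comment> \<open>\<open>conj_cong\<close> makes the arc condition available here: it ensures that
    the two arc labellings are extensional on the same set.\<close>
  proof (intro conj_cong refl)
    assume arcs: ?arcs
    show "(\<lambda>(\<alpha>, \<beta>)\<in>map_prod g g ` ?A. alabel \<Gamma> (?g' \<alpha>, ?g' \<beta>)) = alabel \<Gamma> \<longleftrightarrow>
      (\<forall>p\<in>map_prod g g ` ?A. alabel \<Gamma> (map_prod ?g' ?g' p) = alabel \<Gamma> p)"
      unfolding arcs using al by (auto simp: fun_eq_iff restrict_def extensional_def)
  qed
  also have "(\<forall>p\<in>map_prod g g ` ?A. alabel \<Gamma> (map_prod ?g' ?g' p) = alabel \<Gamma> p) \<longleftrightarrow> ?alab"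
  proof -
    have "map_prod ?g' ?g' (map_prod g g p) = p" if "p \<in> ?A" for p
      using that AV g'g by (cases p) auto
    then show ?thesis
      by (auto simp del: map_prod_simp)
  qed
  finally show ?thesis .
qed

lemma rename_id: "\<Gamma> \<in> labelled_digraphs L V \<Longrightarrow> rename \<Gamma> id = \<Gamma>"
  by (subst rename_eq_iff) (auto simp: permutes_id prod.map_id0)

text \<open>Each condition in \<open>rename_eq_iff\<close> is checked on a single pair, where
  \<open>g\<close> can be replaced by an element of \<open>G\<close>.\<close>

lemma rename_pairwise_closure:
  assumes \<Gamma>: "\<Gamma> \<in> labelled_digraphs L \<Omega>" and G: "subgroup G (Sym \<Omega>)"
    and fixed: "\<And>h. h \<in> G \<Longrightarrow> rename \<Gamma> h = \<Gamma>" and g: "g \<in> pairwise_closure \<Omega> G"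
  shows "rename \<Gamma> g = \<Gamma>"
proof -
  let ?A = "parcs (graph \<Gamma>)"
  have AV: "?A \<subseteq> \<Omega> \<times> \<Omega>"
    using \<Gamma> pair_wf_digraph.in_arcsD1 pair_wf_digraph.in_arcsD2
    by (auto simp: labelled_digraphs_def)
  have perm: "k permutes \<Omega>" if "k \<in> pairwise_closure \<Omega> G" for k
    using that by (simp add: pairwise_closure_def)
  have inv: "inv g \<in> pairwise_closure \<Omega> G"
    using subgroup_pairwise_closure[OF G] g by (simp add: subgroup_Sym_iff)
  have fixedD: "map_prod h h ` ?A = ?A" "\<forall>\<alpha>\<in>\<Omega>. vlabel \<Gamma> (h \<alpha>) = vlabel \<Gamma> \<alpha>"
    "\<forall>p\<in>?A. alabel \<Gamma> (map_prod h h p) = alabel \<Gamma> p" if "h \<in> G" for h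
    using fixed[OF that] rename_eq_iff[OF \<Gamma>] that G by (auto simp: subgroup_Sym_iff)
  \<comment> \<open>The claim is made for all \<open>k\<close> in the closure because it is applied
    to \<open>inv g\<close> as well as to \<open>g\<close>.\<close>
  have pair: "map_prod k k p \<in> ?A \<and> alabel \<Gamma> (map_prod k k p) = alabel \<Gamma> p"
    if k: "k \<in> pairwise_closure \<Omega> G" and p: "p \<in> ?A" for k p
  proof -
    obtain h where "h \<in> G" "map_prod k k p = map_prod h h p"
      using pairwise_closureD[OF k, of p] p AV by (auto elim: pair_orbitE simp del: map_prod_simp)
    then show ?thesis
      using fixedD p by auto
  qed
  have "map_prod g g ` ?A = ?A"
  proof
    show "map_prod g g ` ?A \<subseteq> ?A"
      by (rule image_subsetI) (simp add: pair[OF g])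
    \<comment> \<open>Every arc is the image under \<open>g\<close> of its preimage, which is an arc
      by \<open>pair\<close> for \<open>inv g\<close>.\<close>
    have "p = map_prod g g (map_prod (inv g) (inv g) p)" for p
      by (cases p) (simp add: permutes_inverses[OF perm[OF g]])
    then show "?A \<subseteq> map_prod g g ` ?A"
      using pair[OF inv] by (metis image_eqI subsetI)
  qed
  \<comment> \<open>A vertex is treated as the diagonal pair (\<alpha>, \<alpha>).\<close>
  moreover have "vlabel \<Gamma> (g \<alpha>) = vlabel \<Gamma> \<alpha>" if "\<alpha> \<in> \<Omega>" for \<alpha>
    using mem_pairwise_closureE[OF g that that] fixedD(2) that by metis
  ultimately show ?thesis
    using pair[OF g] rename_eq_iff[OF \<Gamma> perm[OF g]] by blast
qed

section \<open>Orbital digraphs\<close>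

text \<open>The same label \<open>l\<close> sits on every vertex and arc, so only the arc set can
  restrict a permutation.\<close>

definition orbital_digraph ::
    "'l \<Rightarrow> 'a set \<Rightarrow> ('a \<Rightarrow> 'a) set \<Rightarrow> 'a \<times> 'a \<Rightarrow> ('a, 'l) labelled_digraph" where
  "orbital_digraph l \<Omega> G p =
    \<lparr> graph = \<lparr> pverts = \<Omega>, parcs = pair_orbit G p \<rparr>,
      vlabel = (\<lambda>_ \<in> \<Omega>. l), alabel = (\<lambda>_ \<in> pair_orbit G p. l) \<rparr>"

lemma orbital_digraph_mem:
  assumes "subgroup G (Sym \<Omega>)" "l \<in> L" "p \<in> \<Omega> \<times> \<Omega>"
  shows "orbital_digraph l \<Omega> G p \<in> labelled_digraphs L \<Omega>"
proof -
  have "pair_orbit G p \<subseteq> \<Omega> \<times> \<Omega>"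
    using assms by (auto simp: pair_orbit_def subgroup_Sym_iff permutes_in_image)
  then show ?thesis
    using assms(2) unfolding labelled_digraphs_def orbital_digraph_def
    by (auto intro!: pair_wf_digraph.intro)
qed

lemma rename_orbital_digraph_iff:
  assumes G: "subgroup G (Sym \<Omega>)" and p: "p \<in> \<Omega> \<times> \<Omega>" and g: "g permutes \<Omega>"
  shows "rename (orbital_digraph l \<Omega> G p) g = orbital_digraph l \<Omega> G p \<longleftrightarrow>
    map_prod g g ` pair_orbit G p = pair_orbit G p"
  \<comment> \<open>Membership is taken with \<open>UNIV\<close> as the label set, which puts no
    condition on \<open>l\<close>.\<close>
  unfolding rename_eq_iff[OF orbital_digraph_mem[OF G UNIV_I p] g]
  by (auto simp: orbital_digraph_def permutes_in_image[OF g] simp del: map_prod_simp)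

text \<open>Preserving every orbit sends each pair into its own orbit, which gives one inclusion.
  For the other, \<open>G\<close> fixes all orbital digraphs, and
  \<open>rename_pairwise_closure\<close> extends this to the closure.\<close>

lemma Transp_orbital_digraphs:
  assumes G: "subgroup G (Sym \<Omega>)" and ps: "set ps = \<Omega> \<times> \<Omega>"
  shows "Transp \<Omega> (stack_act rename) (map (orbital_digraph l \<Omega> G) ps)
      (map (orbital_digraph l \<Omega> G) ps) = pairwise_closure \<Omega> G" (is "?T = _")
proof
  have T: "g \<in> ?T \<longleftrightarrow> g permutes \<Omega> \<and>
      (\<forall>p\<in>\<Omega> \<times> \<Omega>. map_prod g g ` pair_orbit G p = pair_orbit G p)" for g
    using rename_orbital_digraph_iff[OF G, of _ g l]
    by (simp add: Transp_def stack_act_def ps cong: conj_cong)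
  show "?T \<subseteq> pairwise_closure \<Omega> G"
  proof
    fix g assume "g \<in> ?T"
    then show "g \<in> pairwise_closure \<Omega> G"
      using self_mem_pair_orbit[OF G] unfolding T pairwise_closure_def by blast
  qed
  have "G \<subseteq> ?T"
  proof
    fix g assume g: "g \<in> G"
    have "map_prod g g ` pair_orbit G p = pair_orbit G p" for p
    proof
      show "map_prod g g ` pair_orbit G p \<subseteq> pair_orbit G p"
        by (rule image_subsetI) (rule map_prod_mem_pair_orbit[OF G g])
      have inv: "inv g \<in> G" and perm: "g permutes \<Omega>"
        using G g by (auto simp: subgroup_Sym_iff)
      have "q = map_prod g g (map_prod (inv g) (inv g) q)" for q
        by (cases q) (simp add: permutes_inverses[OF perm])
      then show "pair_orbit G p \<subseteq> map_prod g g ` pair_orbit G p"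
        using map_prod_mem_pair_orbit[OF G inv] by (metis image_eqI subsetI)
    qed
    then show "g \<in> ?T"
      using G g unfolding T subgroup_Sym_iff by blast
  qed
  then have fixed: "rename (orbital_digraph l \<Omega> G p) h = orbital_digraph l \<Omega> G p"
    if "p \<in> \<Omega> \<times> \<Omega>" "h \<in> G" for p h
    using that by (auto simp: Transp_def stack_act_def ps)
  have "rename (orbital_digraph l \<Omega> G p) g = orbital_digraph l \<Omega> G p"
    if "p \<in> \<Omega> \<times> \<Omega>" "g \<in> pairwise_closure \<Omega> G" for p g
    by (rule rename_pairwise_closure[OF orbital_digraph_mem[OF G UNIV_I that(1)] G
          fixed[OF that(1)] that(2)])
  then show "pairwise_closure \<Omega> G \<subseteq> ?T"
    by (auto simp: Transp_def stack_act_def ps pairwise_closure_def simp del: map_prod_simp)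
qed

section \<open>Perfect refiners and stabilisers\<close>

text \<open>Equal lengths put the seam of both concatenations at the same position, so the entrywise
  equations split there.\<close>

lemma Transp_stack_append:
  "length S = length T \<Longrightarrow> Transp \<Omega> (stack_act act) (S @ S') (T @ T') =
    Transp \<Omega> (stack_act act) S T \<inter> Transp \<Omega> (stack_act act) S' T'"
  by (auto simp: Transp_def stack_act_def)

text \<open>Appending \<open>F\<close> to both stacks intersects their transporter with the
  stabiliser of \<open>F\<close>, which is \<open>U\<close>.\<close>

lemma perfect_refiner_const:
  assumes F: "F \<in> Stacks \<O>" and U: "Transp \<Omega> (stack_act act) F F = U"
  shows "perfect_refiner \<Omega> \<O> act U (\<lambda>_. F) (\<lambda>_. F)"
proof -
  have "U \<subseteq> carrier (Sym \<Omega>)"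
    using U by (auto simp: Transp_def)
  then show ?thesis
    unfolding perfect_refiner_def refiner_def
    using F U Transp_stack_append[of _ _ \<Omega> act F F] by auto
qed

theorem corollary7p3:
  fixes \<Omega> :: "'a set" and L :: "'l set" and G :: "('a \<Rightarrow> 'a) set"
  assumes "finite \<Omega>" and "\<Omega> \<noteq> {}" and "L \<noteq> {}" and "subgroup G (Sym \<Omega>)"
  shows "(\<exists>f\<^sub>L f\<^sub>R. perfect_refiner \<Omega> (labelled_digraphs L \<Omega>) rename G f\<^sub>L f\<^sub>R) \<longleftrightarrow>
         two_closed \<Omega> G"
proof
  note G = assms(4)
  assume "\<exists>f\<^sub>L f\<^sub>R. perfect_refiner \<Omega> (labelled_digraphs L \<Omega>) rename G f\<^sub>L f\<^sub>R"
  then obtain f\<^sub>L f\<^sub>R where pr: "perfect_refiner \<Omega> (labelled_digraphs L \<Omega>) rename G f\<^sub>L f\<^sub>R"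
    by blast
  define F where "F = f\<^sub>L []"
  have F: "F \<in> Stacks (labelled_digraphs L \<Omega>)"
    using pr unfolding F_def perfect_refiner_def refiner_def by blast
  let ?E = "[] :: ('a, 'l) labelled_digraph list"
  \<comment> \<open>Every permutation carries the empty stack to itself, so this instance presents
    \<open>G\<close> as a single transporter.\<close>
  have "G \<inter> Transp \<Omega> (stack_act rename) ?E ?E = Transp \<Omega> (stack_act rename) F (f\<^sub>R [])"
    using pr unfolding perfect_refiner_def F_def
    by (elim conjE ballE[of _ _ "[]"] impE) simp_all
  moreover have "G \<inter> Transp \<Omega> (stack_act rename) ?E ?E = G"
    using G by (auto simp: Transp_def stack_act_def subgroup_Sym_iff)
  ultimately have G_eq: "G = Transp \<Omega> (stack_act rename) F (f\<^sub>R [])"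
    by simp
  \<comment> \<open>The identity lies in this transporter and fixes \<open>F\<close>, hence
    \<open>f\<^sub>R []\<close> equals \<open>F\<close> and the transporter is a stabiliser.\<close>
  moreover have "id \<in> G"
    using G by (simp add: subgroup_Sym_iff)
  ultimately have "stack_act rename F id = f\<^sub>R []"
    by (simp add: Transp_def)
  moreover have "stack_act rename F id = F"
    using F by (auto simp: stack_act_def in_lists_conv_set intro!: map_idI rename_id)
  ultimately have stab: "G = Transp \<Omega> (stack_act rename) F F"
    using G_eq by simp
  have "pairwise_closure \<Omega> G \<subseteq> G"
  proof
    fix g assume g: "g \<in> pairwise_closure \<Omega> G"
    have "rename \<Gamma> g = \<Gamma>" if \<Gamma>: "\<Gamma> \<in> set F" for \<Gamma>
    proof (rule rename_pairwise_closure[OF _ G _ g])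
      show "\<Gamma> \<in> labelled_digraphs L \<Omega>"
        using F \<Gamma> by auto
      show "rename \<Gamma> h = \<Gamma>" if "h \<in> G" for h
        using that \<Gamma> map_eq_conv[of _ F id] by (subst (asm) stab) (auto simp: Transp_def stack_act_def)
    qed
    then show "g \<in> G"
      using g by (subst stab) (auto simp: Transp_def stack_act_def pairwise_closure_def map_idI)
  qed
  then show "two_closed \<Omega> G"
    using subset_pairwise_closure[OF G] by (auto simp: two_closed_def two_closure_eq[OF G])
next
  note G = assms(4)
  assume "two_closed \<Omega> G"
  then have closed: "pairwise_closure \<Omega> G = G"
    by (simp add: two_closed_def two_closure_eq[OF G])
  \<comment> \<open>Stacks are finite lists; finiteness of \<Omega> allows one stack to hold the
    orbital digraphs of all pairs.\<close>
  obtain ps where ps: "set ps = \<Omega> \<times> \<Omega>"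
    using finite_list[OF finite_cartesian_product[OF assms(1) assms(1)]] by blast
  obtain l where l: "l \<in> L"
    using assms(3) by blast
  let ?F = "map (orbital_digraph l \<Omega> G) ps"
  have "perfect_refiner \<Omega> (labelled_digraphs L \<Omega>) rename G (\<lambda>_. ?F) (\<lambda>_. ?F)"
  proof (rule perfect_refiner_const)
    show "?F \<in> Stacks (labelled_digraphs L \<Omega>)"
      using orbital_digraph_mem[OF G l] ps by auto
  qed (simp only: Transp_orbital_digraphs[OF G ps] closed)
  then show "\<exists>f\<^sub>L f\<^sub>R. perfect_refiner \<Omega> (labelled_digraphs L \<Omega>) rename G f\<^sub>L f\<^sub>R"
    by blast
qed

end
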